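(* Let $\lambda_0\ge 1$ be an integer. The power-law restart strategy type $\lambda_k=\lceil\lambda_0(k+1)^\alpha\rceil$, $k\ge 0$, with restart parameter $\alpha\in\mathbb{R}$, $\alpha\ge 1$, is strictly unbounded (for every $\alpha\ge 1$).
   Context: For an integer $\hat\lambda\ge\lambda_0$ let $\hat k(\hat\lambda)=\min\{k\ge 0 : \lambda_k\ge\hat\lambda\}$. The loss function of the strategy $\lambda_k=\lceil\lambda_0(k+1)^\alpha\rceil$ is $\mathcal{L}^\#(\hat\lambda,\alpha)=\sum_{k=0}^{\hat k(\hat\lambda)}\lambda_k-\hat\lambda$, and the relative loss function is $\ell^\#(\hat\lambda,\alpha)=\mathcal{L}^\#(\hat\lambda,\alpha)/\hat\lambda$. For a fixed restart parameter, an asymptotic lower bound is the limit as $\hat\lambda\to\infty$ of a function $\ell_{\mathrm{low}}(\hat\lambda,\alpha)$ which is a lower bound of the relative loss function for all admissible $\hat\lambda$; the strategy is called strictly unbounded if there exists an infinite ($+\infty$) asymptotic lower bound. *)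

theory Defs
  imports Complex_Main "HOL-Library.Extended_Real"
begin

definition power_law_restart :: "int \<Rightarrow> real \<Rightarrow> nat \<Rightarrow> int" where
  "power_law_restart lambda0 \<alpha> k = \<lceil>real_of_int lambda0 * (real k + 1) powr \<alpha>\<rceil>"

(* The initial value of the sequence is the parameter lambda0 itself, so "lhat \<ge> lam 0"
   below is the admissibility condition "lhat \<ge> lambda0". *)
lemma power_law_restart_0: "power_law_restart lambda0 \<alpha> 0 = lambda0"
  by (simp add: power_law_restart_def)

(* Meaningful only if some lam k reaches lhat, which holds for every lhat when lam is
   unbounded; otherwise LEAST is unspecified. *)
definition khat :: "(nat \<Rightarrow> int) \<Rightarrow> int \<Rightarrow> nat" where
  "khat lam lhat = (LEAST k. lam k \<ge> lhat)"

definition loss :: "(nat \<Rightarrow> int) \<Rightarrow> int \<Rightarrow> int" where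
  "loss lam lhat = (\<Sum>k = 0..khat lam lhat. lam k) - lhat"

definition relative_loss :: "(nat \<Rightarrow> int) \<Rightarrow> int \<Rightarrow> real" where
  "relative_loss lam lhat = real_of_int (loss lam lhat) / real_of_int lhat"

(* The limit is taken in the extended reals, along the integers lhat. *)
definition asymptotic_lower_bound :: "(nat \<Rightarrow> int) \<Rightarrow> ereal \<Rightarrow> bool" where
  "asymptotic_lower_bound lam L \<longleftrightarrow>
     (\<exists>low :: int \<Rightarrow> real.
        (\<forall>lhat \<ge> lam 0. low lhat \<le> relative_loss lam lhat) \<and>
        ((\<lambda>lhat. ereal (low lhat)) \<longlongrightarrow> L) at_top)"

definition strictly_unbounded :: "(nat \<Rightarrow> int) \<Rightarrow> bool" where
  "strictly_unbounded lam \<longleftrightarrow> asymptotic_lower_bound lam \<infinity>"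

end

theory Submission imports Defs
begin

text \<open>
  Let \<open>K\<close> be the index at which the strategy first reaches the target. The roughly \<open>K / 2\<close>
  steps with index between \<open>K / 2\<close> and \<open>K\<close> each cost at least a fixed fraction
  (essentially \<open>2 powr -\<alpha>\<close>) of \<open>lam K\<close>, which itself is at least the target. Hence the
  relative loss is bounded below by a constant multiple of \<open>K\<close>, and \<open>K\<close> tends to infinity
  with the target.
\<close>

lemma power_law_restart_mono:
  assumes "lambda0 \<ge> 0" and "\<alpha> \<ge> 0" and "j \<le> k"
  shows "power_law_restart lambda0 \<alpha> j \<le> power_law_restart lambda0 \<alpha> k"
  unfolding power_law_restart_def
  using assms by (intro ceiling_mono mult_left_mono powr_mono2) auto

lemma power_law_restart_ge:
  "real_of_int lambda0 * (real k + 1) powr \<alpha> \<le> real_of_int (power_law_restart lambda0 \<alpha> k)"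
  unfolding power_law_restart_def by linarith

text \<open>Rounding up adds less than 1, and the unrounded value is at least 1, so it at most
  doubles.\<close>

lemma power_law_restart_le:
  assumes "lambda0 \<ge> 1" and "\<alpha> \<ge> 0"
  shows "real_of_int (power_law_restart lambda0 \<alpha> k) \<le> 2 * (real_of_int lambda0 * (real k + 1) powr \<alpha>)"
proof -
  have "1 * 1 \<le> real_of_int lambda0 * (real k + 1) powr \<alpha>"
    using assms by (intro mult_mono ge_one_powr_ge_zero) auto
  then show ?thesis
    unfolding power_law_restart_def by linarith
qed

lemma power_law_restart_unbounded:
  assumes "lambda0 \<ge> 1" and "\<alpha> \<ge> 1"
  shows "\<exists>k. lhat \<le> power_law_restart lambda0 \<alpha> k"
proof -
  \<comment> \<open>As \<alpha> \<ge> 1, growth is at least linear, so this index is large enough;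
    for negative \<open>lhat\<close> it is 0.\<close>
  define k where "k = nat lhat"
  have "real_of_int lhat \<le> 1 * (real k + 1) powr 1"
    by (simp add: k_def)
  also have "\<dots> \<le> real_of_int lambda0 * (real k + 1) powr \<alpha>"
    using assms by (intro mult_mono powr_mono) auto
  also have "\<dots> \<le> real_of_int (power_law_restart lambda0 \<alpha> k)"
    by (rule power_law_restart_ge)
  finally show ?thesis by auto
qed

lemma le_khat:
  assumes "\<exists>k. lhat \<le> lam k"
  shows "lhat \<le> lam (khat lam lhat)"
  using assms unfolding khat_def by (rule LeastI_ex)

lemma filterlim_khat_at_top:
  assumes "mono lam" and "\<And>lhat. \<exists>k. lhat \<le> lam k"
  shows "filterlim (khat lam) at_top at_top"
  unfolding filterlim_at_top
proof
  fix n
  show "\<forall>\<^sub>F lhat in at_top. n \<le> khat lam lhat"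
    using eventually_gt_at_top[of "lam n"]
  proof eventually_elim
    case (elim lhat)
    \<comment> \<open>A strict inequality between values of a monotone sequence forces the same
      order on the indices.\<close>
    with le_khat[of lhat lam] assms(2) have "lam n < lam (khat lam lhat)"
      by (meson less_le_trans)
    with \<open>mono lam\<close> show ?case
      by (meson monoD leD nle_le)
  qed
qed

text \<open>In the constant, \<open>2 powr -\<alpha>\<close> is the cost of halving the base of the
  power; the 1/4 combines 1/2 for keeping only the upper half of the indices with 1/2 for the
  rounding in the last term.\<close>

lemma sum_power_law_restart_ge:
  assumes "lambda0 \<ge> 1" and "\<alpha> \<ge> 0"
  shows "2 powr -\<alpha> / 4 * real K * real_of_int (power_law_restart lambda0 \<alpha> K)
    \<le> (\<Sum>k<K. real_of_int (power_law_restart lambda0 \<alpha> k))"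
proof -
  \<comment> \<open>The unrounded strategy with \<open>k + 1\<close> replaced by half of
    \<open>K + 1\<close>: a common lower bound for all terms of the upper half.\<close>
  define m where "m = real_of_int lambda0 * ((real K + 1) / 2) powr \<alpha>"
  have m_nonneg: "0 \<le> m" using assms by (simp add: m_def)
  have m_eq: "m = 2 powr -\<alpha> * (real_of_int lambda0 * (real K + 1) powr \<alpha>)"
    by (simp add: m_def powr_divide powr_minus field_simps)
  have "2 powr -\<alpha> / 4 * real K * real_of_int (power_law_restart lambda0 \<alpha> K)
      \<le> 2 powr -\<alpha> / 4 * real K * (2 * (real_of_int lambda0 * (real K + 1) powr \<alpha>))"
    by (intro mult_left_mono power_law_restart_le assms) auto
  also have "\<dots> = real K / 2 * m"
    by (simp add: m_eq)
  also have "\<dots> \<le> real (K - K div 2) * m"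
    by (intro mult_right_mono m_nonneg) linarith
  also have "\<dots> = (\<Sum>k\<in>{K div 2..<K}. m)"
    by simp
  also have "\<dots> \<le> (\<Sum>k\<in>{K div 2..<K}. real_of_int (power_law_restart lambda0 \<alpha> k))"
  proof (rule sum_mono)
    fix k assume "k \<in> {K div 2..<K}"
    \<comment> \<open>Despite the rounding in \<open>K div 2\<close>, 2k + 1 \<ge> K holds for
      either parity of \<open>K\<close>.\<close>
    then have "K + 1 \<le> 2 * (k + 1)" unfolding atLeastLessThan_iff by presburger
    then have "real (K + 1) \<le> real (2 * (k + 1))" by (rule of_nat_mono)
    then have "(real K + 1) / 2 \<le> real k + 1" by simp
    then have "m \<le> real_of_int lambda0 * (real k + 1) powr \<alpha>"
      unfolding m_def using assms by (intro mult_left_mono powr_mono2) auto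
    also have "\<dots> \<le> real_of_int (power_law_restart lambda0 \<alpha> k)"
      by (rule power_law_restart_ge)
    finally show "m \<le> real_of_int (power_law_restart lambda0 \<alpha> k)" .
  qed
  also have "\<dots> \<le> (\<Sum>k<K. real_of_int (power_law_restart lambda0 \<alpha> k))"
  proof (rule sum_mono2)
    fix k
    have "0 \<le> real_of_int lambda0 * (real k + 1) powr \<alpha>" using assms by simp
    then show "0 \<le> real_of_int (power_law_restart lambda0 \<alpha> k)"
      using power_law_restart_ge order_trans by blast
  qed auto
  finally show ?thesis .
qed

lemma relative_loss_power_law_restart_ge:
  assumes "lambda0 \<ge> 1" and "\<alpha> \<ge> 1" and "lhat \<ge> 1"
  shows "2 powr -\<alpha> / 4 * real (khat (power_law_restart lambda0 \<alpha>) lhat)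
    \<le> relative_loss (power_law_restart lambda0 \<alpha>) lhat"
proof -
  define lam where "lam = power_law_restart lambda0 \<alpha>"
  define K where "K = khat lam lhat"
  have reach: "lhat \<le> lam K"
    unfolding K_def lam_def by (intro le_khat power_law_restart_unbounded assms)
  have "2 powr -\<alpha> / 4 * real K * real_of_int lhat \<le> 2 powr -\<alpha> / 4 * real K * real_of_int (lam K)"
    using reach by (intro mult_left_mono) auto
  also have "\<dots> \<le> (\<Sum>k<K. real_of_int (lam k))"
    unfolding lam_def using assms by (intro sum_power_law_restart_ge) auto
  \<comment> \<open>The sum in \<open>loss\<close> includes index \<open>K\<close>; that last term
    is at least \<open>lhat\<close> and pays for the subtraction.\<close>
  also have "\<dots> \<le> real_of_int (loss lam lhat)"
    using reach by (simp add: loss_def K_def[symmetric] atLeast0AtMost lessThan_Suc_atMost[symmetric])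
  finally show ?thesis
    using assms(3) by (simp add: relative_loss_def lam_def K_def pos_le_divide_eq)
qed

theorem theorem12:
  fixes lambda0 :: int and \<alpha> :: real
  assumes "lambda0 \<ge> 1" and "\<alpha> \<ge> 1"
  shows "strictly_unbounded (power_law_restart lambda0 \<alpha>)"
proof -
  define lam where "lam = power_law_restart lambda0 \<alpha>"
  define low where "low lhat = 2 powr -\<alpha> / 4 * real (khat lam lhat)" for lhat
  have "mono lam"
    unfolding lam_def using assms by (intro monoI power_law_restart_mono) auto
  then have "filterlim (khat lam) at_top at_top"
    using power_law_restart_unbounded[OF assms] by (intro filterlim_khat_at_top) (auto simp: lam_def)
  then have "filterlim (\<lambda>lhat. real (khat lam lhat)) at_top at_top"
    by (rule filterlim_compose[OF filterlim_real_sequentially])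
  then have "filterlim low at_top at_top"
    unfolding low_def by (intro filterlim_tendsto_pos_mult_at_top[OF tendsto_const]) auto
  then have "((\<lambda>lhat. ereal (low lhat)) \<longlongrightarrow> \<infinity>) at_top"
    by (simp add: tendsto_PInfty_eq_at_top)
  \<comment> \<open>Admissible targets are at least \<open>lam 0 = lambda0 \<ge> 1\<close>, so the
    division by \<open>lhat\<close> is by a positive number.\<close>
  moreover have "low lhat \<le> relative_loss lam lhat" if "lhat \<ge> lam 0" for lhat
    unfolding low_def lam_def
    using that assms by (intro relative_loss_power_law_restart_ge) (auto simp: lam_def power_law_restart_0)
  ultimately show ?thesis
    unfolding strictly_unbounded_def asymptotic_lower_bound_def lam_def by blast
qed

end
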